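(* On a uniform grid, any subdivision scheme of the family given by the rules $$z^{k+1}_{\boldsymbol\ell}=\sum_{\mathbf i\in\mathcal B^{k+1,\boldsymbol\ell}}\alpha^{k+1,\boldsymbol\ell}_{\mathbf i}\,z^k_{\mathbf i},\qquad \alpha^{k+1,\boldsymbol\ell}_{\mathbf i}=\frac{w^{k+1,\boldsymbol\ell}_{\mathbf i}}{\sum_{\mathbf j\in\mathcal B^{k+1,\boldsymbol\ell}}w^{k+1,\boldsymbol\ell}_{\mathbf j}},\qquad k\ge 0,\ \boldsymbol\ell\in\mathbb Z^2,$$ is uniform and level-independent, and its coefficients are positive. That is, for all $k\ge0$ and all $\boldsymbol\ell=2\dot{\boldsymbol\ell}+\bar{\boldsymbol\ell}$ with $\dot{\boldsymbol\ell}\in\mathbb Z^2$, $\bar{\boldsymbol\ell}\in\{0,1\}^2$, one has $\mathcal B^{k+1,\boldsymbol\ell}=\mathcal B^{1,\bar{\boldsymbol\ell}}+\dot{\boldsymbol\ell}$ and $$\alpha^{k+1,\boldsymbol\ell}_{\mathbf i}=\alpha^{1,\bar{\boldsymbol\ell}}_{\mathbf i-\dot{\boldsymbol\ell}},\qquad \alpha^{k+1,\boldsymbol\ell}_{\mathbf i}>0\qquad\text{for all }\mathbf i\in\mathcal B^{k+1,\boldsymbol\ell}.$$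
   Context: Uniform grid: let $\mathbf e^1,\mathbf e^2\in\mathbb R^2$ be linearly independent. The initial triangulation is the image, under the invertible linear map with matrix $[\mathbf e^1,\mathbf e^2]$, of the triangular-rectangular grid (vertices $\mathbb Z^2$, edges joining $\mathbf m$ to $\mathbf m+(1,0)$, $\mathbf m+(0,1)$ and $\mathbf m+(1,1)$). It is refined repeatedly by adding the mid-points of all edges, so the level-$k$ vertices are $\mathbf v^k_{\boldsymbol\ell}=2^{-k}\ell_1\mathbf e^1+2^{-k}\ell_2\mathbf e^2$, $\boldsymbol\ell=(\ell_1,\ell_2)\in\mathbb Z^2$, $k\ge 0$. A scheme of the family is fixed by a real number $L$ larger than the length of every edge of the initial triangulation, i.e. $L>\max\{\|\mathbf e^1\|,\|\mathbf e^2\|,\|\mathbf e^1+\mathbf e^2\|\}$ ($\|\cdot\|$ is the Euclidean norm), and a weight function $W:[0,1)\to(0,1]$. For $k\ge 0$ and $\boldsymbol\ell\in\mathbb Z^2$ the $L$-ball (stencil) and the weights are $$\mathcal B^{k+1,\boldsymbol\ell}=\{\mathbf i\in\mathbb Z^2:\ \|\mathbf v^{k+1}_{\boldsymbol\ell}-\mathbf v^k_{\mathbf i}\|<2^{-k}L\},\qquad w^{k+1,\boldsymbol\ell}_{\mathbf i}=W\!\left(\frac{\|\mathbf v^{k+1}_{\boldsymbol\ell}-\mathbf v^k_{\mathbf i}\|}{2^{-k}L}\right),\ \mathbf i\in\mathcal B^{k+1,\boldsymbol\ell}.$$ "Level-independent" means that the rules do not depend on $k$; "uniform" means that the rules depend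 on the location $\boldsymbol\ell$ only through its parity $\bar{\boldsymbol\ell}$, up to the index shift by $\dot{\boldsymbol\ell}$. *)

theory Defs
  imports "HOL-Analysis.Analysis"
begin

type_synonym idx = "int \<times> int"

definition vertex :: "real^2 \<Rightarrow> real^2 \<Rightarrow> nat \<Rightarrow> idx \<Rightarrow> real^2" where
  "vertex e1 e2 k l =
     (of_int (fst l) / 2 ^ k) *\<^sub>R e1 + (of_int (snd l) / 2 ^ k) *\<^sub>R e2"

(* In the following four definitions k is the level of the coarse grid, so that the objects
   carrying the superscript (k+1, l) in the mathematical notation have the arguments k and l;
   in particular k = 0 gives the objects with superscript (1, l). *)

definition stencil :: "real^2 \<Rightarrow> real^2 \<Rightarrow> real \<Rightarrow> nat \<Rightarrow> idx \<Rightarrow> idx set" where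
  "stencil e1 e2 L k l = {i. norm (vertex e1 e2 (Suc k) l - vertex e1 e2 k i) < L / 2 ^ k}"

(* Only the values at i in the stencil are meaningful: elsewhere W is evaluated outside [0,1). *)
definition weight ::
  "real^2 \<Rightarrow> real^2 \<Rightarrow> real \<Rightarrow> (real \<Rightarrow> real) \<Rightarrow> nat \<Rightarrow> idx \<Rightarrow> idx \<Rightarrow> real" where
  "weight e1 e2 L W k l i =
     W (norm (vertex e1 e2 (Suc k) l - vertex e1 e2 k i) / (L / 2 ^ k))"

definition coefficient ::
  "real^2 \<Rightarrow> real^2 \<Rightarrow> real \<Rightarrow> (real \<Rightarrow> real) \<Rightarrow> nat \<Rightarrow> idx \<Rightarrow> idx \<Rightarrow> real" where
  "coefficient e1 e2 L W k l i =
     weight e1 e2 L W k l i / (\<Sum>j\<in>stencil e1 e2 L k l. weight e1 e2 L W k l j)"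

(* The map taking the level-k data z to the level-(k+1) data. *)
definition ball_scheme ::
  "real^2 \<Rightarrow> real^2 \<Rightarrow> real \<Rightarrow> (real \<Rightarrow> real) \<Rightarrow> nat \<Rightarrow> (idx \<Rightarrow> real) \<Rightarrow> (idx \<Rightarrow> real)" where
  "ball_scheme e1 e2 L W k z l =
     (\<Sum>i\<in>stencil e1 e2 L k l. coefficient e1 e2 L W k l i * z i)"

(* A scheme is a sequence of maps S k from level-k data to level-(k+1) data;
   its rule at location l is z \<mapsto> S k z l. *)

definition level_independent :: "(nat \<Rightarrow> (idx \<Rightarrow> real) \<Rightarrow> (idx \<Rightarrow> real)) \<Rightarrow> bool" where
  "level_independent S \<longleftrightarrow> (\<forall>k k'. S k = S k')"

(* With l = 2 d + p, the rule at l is the rule at the parity p applied to the data shifted by d. *)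
definition uniform_scheme :: "(nat \<Rightarrow> (idx \<Rightarrow> real) \<Rightarrow> (idx \<Rightarrow> real)) \<Rightarrow> bool" where
  "uniform_scheme S \<longleftrightarrow>
     (\<forall>k z d. \<forall>p\<in>{0, 1} \<times> {0, 1}.
        S k z (2 * fst d + fst p, 2 * snd d + snd p) = S k (\<lambda>i. z (i + d)) p)"

end

theory Submission
  imports Defs
begin

text \<open>
  For \<open>l = 2 d + p\<close> the vector from \<open>v\<close>(k,i) to \<open>v\<close>(k+1,l) is \<open>1 / 2 ^ k\<close> times the vector from
  \<open>v\<close>(0,i - d) to \<open>v\<close>(1,p), and the stencil radius carries the same factor. Hence stencils and
  weights at level \<open>k\<close> and location \<open>l\<close> are translates of those at level 0 and location \<open>p\<close>. Linear
  independence makes the lattice discrete, so stencils are finite and the normalising sums are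
  positive.
\<close>

lemma vertex_diff_rescale:
  "vertex e1 e2 (Suc k) (2 * fst d + fst p, 2 * snd d + snd p) - vertex e1 e2 k i
     = (1 / 2 ^ k) *\<^sub>R (vertex e1 e2 (Suc 0) p - vertex e1 e2 0 (i - d))"
proof -
  \<comment> \<open>Here \<open>c\<close> stands for \<open>2 ^ k\<close>: since the fine grid has
    half the spacing, the even part \<open>2 * a\<close> of a fine index is a whole coarse step
    \<open>a\<close>, which moves over to the coarse index.\<close>
  have "(2 * a + b) / (2 * c) - i / c = (1 / c) * (b / 2 - (i - a))" if "c \<noteq> 0" for a b c i :: real
    using that by (simp add: field_simps)
  then have coord: "(2 * a + b) / (2 * 2 ^ k) - i / 2 ^ k = (1 / 2 ^ k) * (b / 2 - (i - a))"
    for a b i :: real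
    by simp
  have "(a *\<^sub>R e1 + b *\<^sub>R e2) - (a' *\<^sub>R e1 + b' *\<^sub>R e2) = (a - a') *\<^sub>R e1 + (b - b') *\<^sub>R e2"
    for a b a' b' :: real
    by (simp add: algebra_simps)
  then show ?thesis
    by (simp add: vertex_def coord scaleR_add_right)
qed

lemma norm_vertex_diff_rescale:
  "norm (vertex e1 e2 (Suc k) (2 * fst d + fst p, 2 * snd d + snd p) - vertex e1 e2 k i)
     = norm (vertex e1 e2 (Suc 0) p - vertex e1 e2 0 (i - d)) / 2 ^ k"
  by (simp add: vertex_diff_rescale)

lemma stencil_shift:
  "stencil e1 e2 L k (2 * fst d + fst p, 2 * snd d + snd p) = (\<lambda>i. i + d) ` stencil e1 e2 L 0 p"
proof -
  have "i \<in> stencil e1 e2 L k (2 * fst d + fst p, 2 * snd d + snd p)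
      \<longleftrightarrow> i - d \<in> stencil e1 e2 L 0 p" for i
    unfolding stencil_def mem_Collect_eq norm_vertex_diff_rescale
    by (simp add: divide_less_cancel)
  then show ?thesis
    by (force intro: image_eqI[where x = "i - d" for i])
qed

text \<open>The factor \<open>1 / 2 ^ k\<close> cancels in the argument of \<open>W\<close>, so both
  sides evaluate \<open>W\<close> at the same number, for \<open>i\<close> outside the stencil as
  well.\<close>

lemma weight_shift:
  "weight e1 e2 L W k (2 * fst d + fst p, 2 * snd d + snd p) i = weight e1 e2 L W 0 p (i - d)"
  unfolding weight_def norm_vertex_diff_rescale by simp

lemma coefficient_shift:
  "coefficient e1 e2 L W k (2 * fst d + fst p, 2 * snd d + snd p) i
     = coefficient e1 e2 L W 0 p (i - d)"
  unfolding coefficient_def stencil_shift weight_shift by (simp add: sum.reindex)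

text \<open>The right-hand side is at level 0, so this one identity yields both uniformity and
  level-independence.\<close>

lemma ball_scheme_shift:
  "ball_scheme e1 e2 L W k z (2 * fst d + fst p, 2 * snd d + snd p)
     = ball_scheme e1 e2 L W 0 (\<lambda>i. z (i + d)) p"
  unfolding ball_scheme_def stencil_shift coefficient_shift by (simp add: sum.reindex)

text \<open>Splitting \<open>l\<close> by \<open>div\<close> and \<open>mod\<close> 2 brings both
  sides to the same level-0 rule at the parity of \<open>l\<close>.\<close>

lemma ball_scheme_level: "ball_scheme e1 e2 L W k z l = ball_scheme e1 e2 L W 0 z l"
proof -
  have l: "l = (2 * fst d + fst p, 2 * snd d + snd p)"
    if "d = (fst l div 2, snd l div 2)" "p = (fst l mod 2, snd l mod 2)" for d p
    using that by simp
  show ?thesis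
    by (subst (1 2) l[OF refl refl]) (simp only: ball_scheme_shift)
qed

lemma finite_stencil:
  assumes "e1 \<noteq> e2" "independent {e1, e2}"
  shows "finite (stencil e1 e2 L k l)"
proof -
  define f where "f = (\<lambda>x :: real \<times> real. fst x *\<^sub>R e1 + snd x *\<^sub>R e2)"
  have "linear f"
    unfolding f_def by (rule linearI) (simp_all add: algebra_simps)
  moreover have "inj f"
  proof -
    have "x = 0" if "f x = 0" for x
    proof -
      \<comment> \<open>Independence speaks of coefficients indexed by the vectors themselves;
        \<open>e1 \<noteq> e2\<close> lets \<open>u\<close> carry both coordinates of
        \<open>x\<close>.\<close>
      define u where "u = (\<lambda>v. if v = e1 then fst x else snd x)"
      have "(\<Sum>v\<in>{e1, e2}. u v *\<^sub>R v) = 0"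
        using that assms(1) by (simp add: f_def u_def)
      then have "u e1 = 0" "u e2 = 0"
        using independentD[OF assms(2), of "{e1, e2}" u] by simp_all
      then show ?thesis
        using assms(1) by (simp add: u_def prod_eq_iff)
    qed
    then show ?thesis
      using linear_injective_0[OF \<open>linear f\<close>] by blast
  qed
  ultimately obtain B where B: "B > 0" "\<And>x. B * norm x \<le> norm (f x)"
    using linear_inj_bounded_below_pos by blast
  \<comment> \<open>A stencil vertex has norm below
    \<open>norm (vertex e1 e2 (Suc k) l) + L / 2 ^ k\<close>; the factor \<open>2 ^ k\<close> undoes
    the grid scaling, and \<open>B\<close> turns a bound on \<open>f\<close> into one on the integer
    coordinates.\<close>
  define r where "r = (norm (vertex e1 e2 (Suc k) l) + L / 2 ^ k) * 2 ^ k / B"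
  have bound: "\<bar>real_of_int (fst i)\<bar> \<le> r \<and> \<bar>real_of_int (snd i)\<bar> \<le> r"
    if "i \<in> stencil e1 e2 L k l" for i
  proof -
    let ?x = "(real_of_int (fst i), real_of_int (snd i))"
    have "vertex e1 e2 k i = (1 / 2 ^ k) *\<^sub>R f ?x"
      by (simp add: vertex_def f_def scaleR_add_right)
    then have "norm (f ?x) / 2 ^ k = norm (vertex e1 e2 k i)"
      by simp
    also have "\<dots> \<le> norm (vertex e1 e2 (Suc k) l) + L / 2 ^ k"
      using that norm_triangle_sub[of "vertex e1 e2 k i" "vertex e1 e2 (Suc k) l"]
      by (simp add: stencil_def norm_minus_commute)
    finally have "norm (f ?x) \<le> (norm (vertex e1 e2 (Suc k) l) + L / 2 ^ k) * 2 ^ k"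
      by (simp add: pos_divide_le_eq)
    then have "norm ?x \<le> r"
      using B(1) B(2)[of ?x] unfolding r_def pos_le_divide_eq[OF B(1)]
      by (simp add: mult.commute)
    then show ?thesis
      using norm_fst_le[of "real_of_int (fst i)" "real_of_int (snd i)"]
        norm_snd_le[of "real_of_int (snd i)" "real_of_int (fst i)"] by simp
  qed
  have "stencil e1 e2 L k l \<subseteq> {-\<lceil>r\<rceil>..\<lceil>r\<rceil>} \<times> {-\<lceil>r\<rceil>..\<lceil>r\<rceil>}"
  proof
    fix i assume "i \<in> stencil e1 e2 L k l"
    then have "\<bar>fst i\<bar> \<le> \<lceil>r\<rceil>" "\<bar>snd i\<bar> \<le> \<lceil>r\<rceil>"
      using bound[of i] by linarith+
    then show "i \<in> {-\<lceil>r\<rceil>..\<lceil>r\<rceil>} \<times> {-\<lceil>r\<rceil>..\<lceil>r\<rceil>}"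
      by (auto simp: mem_Times_iff)
  qed
  then show ?thesis
    by (rule finite_subset) simp
qed

lemma weight_pos:
  assumes "W \<in> {0..<1} \<rightarrow> {0<..1}" "i \<in> stencil e1 e2 L k l"
  shows "weight e1 e2 L W k l i > 0"
proof -
  let ?n = "norm (vertex e1 e2 (Suc k) l - vertex e1 e2 k i)"
  have "?n < L / 2 ^ k"
    using assms(2) by (simp add: stencil_def)
  \<comment> \<open>The radius is positive because it strictly exceeds a norm.\<close>
  moreover from this have "0 < L / 2 ^ k"
    by (rule le_less_trans[OF norm_ge_zero])
  ultimately have "?n / (L / 2 ^ k) \<in> {0..<1}"
    using divide_less_eq_1_pos[of "L / 2 ^ k" ?n] divide_nonneg_pos[of ?n "L / 2 ^ k"]
    by (simp del: divide_divide_eq_right)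
  then show ?thesis
    using assms(1) unfolding weight_def by fastforce
qed

lemma coefficient_pos:
  assumes "e1 \<noteq> e2" "independent {e1, e2}" "W \<in> {0..<1} \<rightarrow> {0<..1}"
    and "i \<in> stencil e1 e2 L k l"
  shows "coefficient e1 e2 L W k l i > 0"
proof -
  \<comment> \<open>Finiteness matters, as a sum over an infinite set would be 0 by convention;
    \<open>i\<close> itself shows that the stencil is nonempty.\<close>
  have "(\<Sum>j\<in>stencil e1 e2 L k l. weight e1 e2 L W k l j) > 0"
    using assms weight_pos finite_stencil by (intro sum_pos) auto
  then show ?thesis
    using weight_pos[OF assms(3,4)] by (simp add: coefficient_def)
qed

theorem theorem4p1:
  fixes e1 e2 :: "real^2" and L :: real and W :: "real \<Rightarrow> real"
  assumes "e1 \<noteq> e2" and "independent {e1, e2}"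
    and "L > Max {norm e1, norm e2, norm (e1 + e2)}"
    and "W \<in> {0..<1} \<rightarrow> {0<..1}"
  shows "uniform_scheme (ball_scheme e1 e2 L W)
    \<and> level_independent (ball_scheme e1 e2 L W)
    \<and> (\<forall>(k::nat) (l::idx) (d::idx) (p::idx).
         p \<in> {0, 1} \<times> {0, 1} \<and> l = (2 * fst d + fst p, 2 * snd d + snd p) \<longrightarrow>
           stencil e1 e2 L k l = (\<lambda>i. i + d) ` stencil e1 e2 L 0 p
         \<and> (\<forall>i\<in>stencil e1 e2 L k l.
              coefficient e1 e2 L W k l i = coefficient e1 e2 L W 0 p (i - d)
            \<and> coefficient e1 e2 L W k l i > 0))"
proof (intro conjI allI impI ballI)
  show "uniform_scheme (ball_scheme e1 e2 L W)"
    \<comment> \<open>The shift identity lands at level 0, whereas uniformity compares two rules at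
      level \<open>k\<close>; \<open>ball_scheme_level\<close> bridges the gap.\<close>
    unfolding uniform_scheme_def ball_scheme_shift by (metis ball_scheme_level)
  show "level_independent (ball_scheme e1 e2 L W)"
    unfolding level_independent_def by (metis ball_scheme_level ext)
  fix k :: nat and l d p :: idx
  assume "p \<in> {0, 1} \<times> {0, 1} \<and> l = (2 * fst d + fst p, 2 * snd d + snd p)"
  then have l: "l = (2 * fst d + fst p, 2 * snd d + snd p)" ..
  show "stencil e1 e2 L k l = (\<lambda>i. i + d) ` stencil e1 e2 L 0 p"
    unfolding l by (rule stencil_shift)
  fix i assume "i \<in> stencil e1 e2 L k l"
  then show "coefficient e1 e2 L W k l i > 0"
    using assms coefficient_pos by blast
  show "coefficient e1 e2 L W k l i = coefficient e1 e2 L W 0 p (i - d)"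
    unfolding l by (rule coefficient_shift)
qed

end
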